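(* Let $N\ge 2$ be an integer and let $r,s\geq 1$ be integers. Let $C_1[0..r]$ and $C_2[0..s]$ be strictly increasing arrays of integers with $C_1[0] = C_2[0] = 0$ and $C_1[r] = C_2[s] = N$ (sorted change-point sets with the auxiliary change-points $0$ and $N$ added at both ends). Then the procedure RICPD (given in the context), on input $(C_1,C_2)$, returns the Rand Index between the clusterings $\{\{C_1[i]+1,\ldots,C_1[i+1]\} : 0\le i\le r-1\}$ and $\{\{C_2[j]+1,\ldots,C_2[j+1]\} : 0\le j\le s-1\}$ of $\{1,\ldots,N\}$. Moreover, it runs in $O(r+s)$ time and uses $O(1)$ auxiliary memory (beyond the input), with implied constants independent of $N$, $r$, $s$ and the input arrays.
   Context: A clustering of $\{1,\ldots,N\}$ is a partition of $\{1,\ldots,N\}$ into nonempty sets, called clusters. For a clustering $P$, let $I_P(i,j) = 1$ if $i$ and $j$ belong to the same cluster of $P$ and $I_P(i,j)=0$ otherwise. Given two clusterings $P_1,P_2$ of $\{1,\ldots,N\}$, let $N_{11}$ (respectively $N_{00}$) be the number of pairs $(i,j)\in\{1,\ldots,N\}^2$ with $i<j$ and $I_{P_1}(i,j)=I_{P_2}(i,j)=1$ (respectively $I_{P_1}(i,j)=I_{P_2}(i,j)=0$). The Rand Index between $P_1$ and $P_2$ is $RI = (N_{00}+N_{11})/\binom{N}{2}$. Procedure RICPD$(C_1,C_2)$: (1) Set $r \gets \mathrm{size}(C_1)-1$, $s\gets \mathrm{size}(C_2)-1$, $d\gets 0$, $b\gets 0$. (2) For $i = 0,1,\ldots,r-1$: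 for $j = b, b+1,\ldots,s-1$ (with $b$ taken at the value it has when this inner loop starts; the loop is empty if $b>s-1$), do: (a) $m\gets \min(C_1[i+1],C_2[j+1]) - \max(C_1[i],C_2[j])$; (b) $m\gets\max(0,m)$; (c) $d\gets d + m\,|C_1[i+1]-C_2[j+1]|$; (d) if $C_1[i+1]<C_2[j+1]$, break out of the inner loop (over $j$); otherwise set $b\gets j+1$. (3) Set $N\gets C_1[r]$ and return $1 - d/\binom{N}{2}$. Time is the number of elementary operations (arithmetic operations, comparisons, assignments, array accesses), each counted at unit cost; memory is the number of stored numbers. *)

theory Defs
  imports Complex_Main "HOL-Library.Disjoint_Sets" "HOL-Library.Monad_Syntax"
begin

section \<open>Clusterings and the Rand Index\<close>

definition clustering :: "int \<Rightarrow> int set set \<Rightarrow> bool" where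
  "clustering N P \<longleftrightarrow> partition_on {1..N} P"

definition same_cluster :: "int set set \<Rightarrow> int \<Rightarrow> int \<Rightarrow> nat" where
  "same_cluster P i j = (if \<exists>A\<in>P. i \<in> A \<and> j \<in> A then 1 else 0)"

definition agreeing_pairs :: "nat \<Rightarrow> int \<Rightarrow> int set set \<Rightarrow> int set set \<Rightarrow> nat" where
  "agreeing_pairs v N P1 P2 =
     card {(i, j). i \<in> {1..N} \<and> j \<in> {1..N} \<and> i < j \<and>
                   same_cluster P1 i j = v \<and> same_cluster P2 i j = v}"

definition rand_index :: "int \<Rightarrow> int set set \<Rightarrow> int set set \<Rightarrow> real" where
  "rand_index N P1 P2 =
     real (agreeing_pairs 0 N P1 P2 + agreeing_pairs 1 N P1 P2) / real (nat N choose 2)"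

definition change_point_clustering :: "int list \<Rightarrow> int set set" where
  "change_point_clustering C = {{C ! i + 1 .. C ! (i + 1)} | i. i + 1 < length C}"

lemma clustering_change_point_clustering:
  assumes "length C = r + 1" "sorted_wrt (<) C" "C ! 0 = 0" "C ! r = N"
  shows "clustering N (change_point_clustering C)"
proof -
  have less: "C ! i < C ! j" if "i < j" "j \<le> r" for i j
    using assms(1,2) that by (simp add: sorted_wrt_iff_nth_less)
  have le: "C ! i \<le> C ! j" if "i \<le> j" "j \<le> r" for i j
    using less[of i j] that by (cases "i = j") auto
  have cover: "\<exists>i<k. C ! i + 1 \<le> x \<and> x \<le> C ! (i + 1)"
    if "1 \<le> x" "x \<le> C ! k" "k \<le> r" for x k
    using that
  proof (induction k)
    case 0
    then show ?case using assms(3) by simp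
  next
    case (Suc k)
    show ?case
    proof (cases "x \<le> C ! k")
      case True
      then show ?thesis using Suc by (meson Suc_leD less_SucI)
    next
      case False
      then show ?thesis using Suc.prems by (intro exI[of _ k]) auto
    qed
  qed
  have inside: "1 \<le> x \<and> x \<le> N" if "i < r" "C ! i + 1 \<le> x" "x \<le> C ! (i + 1)" for i x
    using le[of 0 i] le[of "i + 1" r] that assms(3,4) by auto
  have apart: "i = j"
    if "i < r" "j < r" "C ! i + 1 \<le> x" "x \<le> C ! (i + 1)"
       "C ! j + 1 \<le> x" "x \<le> C ! (j + 1)" for i j x
    using that le[of "i + 1" j] le[of "j + 1" i] by (cases i j rule: linorder_cases) auto
  have mem: "A \<in> change_point_clustering C \<longleftrightarrow> (\<exists>i<r. A = {C ! i + 1 .. C ! (i + 1)})" for A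
    unfolding change_point_clustering_def using assms(1) by auto
  have "\<Union> (change_point_clustering C) = {1..N}"
  proof (rule set_eqI)
    fix x
    have "x \<in> \<Union> (change_point_clustering C) \<longleftrightarrow>
        (\<exists>i<r. C ! i + 1 \<le> x \<and> x \<le> C ! (i + 1))"
      using mem by (metis (no_types, lifting) Union_iff atLeastAtMost_iff)
    also have "\<dots> \<longleftrightarrow> x \<in> {1..N}"
      unfolding atLeastAtMost_iff using cover[of x r] inside[of _ x] assms(4) by blast
    finally show "x \<in> \<Union> (change_point_clustering C) \<longleftrightarrow> x \<in> {1..N}" .
  qed
  moreover have "disjoint (change_point_clustering C)"
  proof (rule disjointI)
    fix A B
    assume "A \<in> change_point_clustering C" "B \<in> change_point_clustering C" "A \<noteq> B"
    then obtain i j where ij: "i < r" "A = {C ! i + 1 .. C ! (i + 1)}"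
        "j < r" "B = {C ! j + 1 .. C ! (j + 1)}" "i \<noteq> j"
      unfolding mem by metis
    show "A \<inter> B = {}"
      unfolding ij(2,4) disjoint_iff atLeastAtMost_iff using apart ij(1,3,5) by blast
  qed
  moreover have "{} \<notin> change_point_clustering C"
  proof
    assume "{} \<in> change_point_clustering C"
    then obtain i where "i < r" "{} = {C ! i + 1 .. C ! (i + 1)}"
      unfolding mem by blast
    with less[of i "i + 1"] show False by simp
  qed
  ultimately show ?thesis
    unfolding clustering_def partition_on_def by blast
qed


section \<open>A small imperative language with unit costs\<close>

text \<open>
  Programs work on scalar variables, each holding one number, and on read-only input arrays.
  There is no syntax for writing to an array, so the input cannot serve as working memory.
\<close>

datatype binop = Add | Sub | Mul | Div | Minimum | Maximum

datatype exp =
    Const real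
  | Var string
  | Size string
  | Elem string exp
  | Absolute exp
  | Bin binop exp exp

datatype com =
    Assign string exp
  | Seq com com
  | If_Less exp exp com com
  | For string exp exp com
  | Break

type_synonym store = "string \<rightharpoonup> real"
type_synonym arrays = "string \<rightharpoonup> int list"

fun apply_binop :: "binop \<Rightarrow> real \<Rightarrow> real \<Rightarrow> real option" where
  "apply_binop Add x y = Some (x + y)"
| "apply_binop Sub x y = Some (x - y)"
| "apply_binop Mul x y = Some (x * y)"
| "apply_binop Div x y = (if y = 0 then None else Some (x / y))"
| "apply_binop Minimum x y = Some (min x y)"
| "apply_binop Maximum x y = Some (max x y)"

definition read_array :: "int list \<Rightarrow> real \<Rightarrow> real option" where
  "read_array A x =
     (if x \<in> \<nat> \<and> x < real (length A) then Some (real_of_int (A ! nat \<lfloor>x\<rfloor>)) else None)"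

text \<open>
  The result is the value, the number of elementary operations, and the largest number of
  temporaries held at once during evaluation (the result included). Evaluation is stuck on
  an unset variable, an unknown array, an index out of bounds, and division by zero.
\<close>

primrec eval :: "arrays \<Rightarrow> store \<Rightarrow> exp \<Rightarrow> (real \<times> nat \<times> nat) option" where
  "eval I \<sigma> (Const x) = Some (x, 0, 1)"
| "eval I \<sigma> (Var x) = do {v \<leftarrow> \<sigma> x; Some (v, 0, 1)}"
| "eval I \<sigma> (Size a) = do {A \<leftarrow> I a; Some (real (length A), 1, 1)}"
| "eval I \<sigma> (Elem a e) = do {
     A \<leftarrow> I a;
     (i, t, m) \<leftarrow> eval I \<sigma> e;
     v \<leftarrow> read_array A i;
     Some (v, t + 1, m)}"
| "eval I \<sigma> (Absolute e) = do {
     (v, t, m) \<leftarrow> eval I \<sigma> e;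
     Some (\<bar>v\<bar>, t + 1, m)}"
| "eval I \<sigma> (Bin f e1 e2) = do {
     (v1, t1, m1) \<leftarrow> eval I \<sigma> e1;
     (v2, t2, m2) \<leftarrow> eval I \<sigma> e2;
     v \<leftarrow> apply_binop f v1 v2;
     Some (v, t1 + t2 + 1, max m1 (1 + m2))}"

definition stored :: "store \<Rightarrow> nat" where
  "stored \<sigma> = card (dom \<sigma>)"

text \<open>
  The result is a flag telling whether a break is pending, the new store, the number of
  elementary operations, and the largest number of scalars held at once (variables and
  temporaries). Each iteration of a loop is charged three operations (test, assignment of
  the loop variable, increment), and the failing test at the end is charged one.
\<close>

fun iterate ::
  "(store \<Rightarrow> (bool \<times> store \<times> nat \<times> nat) option) \<Rightarrow> string \<Rightarrow> real list \<Rightarrow> store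
    \<Rightarrow> (store \<times> nat \<times> nat) option" where
  "iterate body x [] \<sigma> = Some (\<sigma>, 1, stored \<sigma>)"
| "iterate body x (v # vs) \<sigma> = do {
     (brk, \<sigma>1, t1, m1) \<leftarrow> body (\<sigma>(x \<mapsto> v));
     if brk then Some (\<sigma>1, t1 + 3, max (stored \<sigma>) m1)
     else do {
       (\<sigma>2, t2, m2) \<leftarrow> iterate body x vs \<sigma>1;
       Some (\<sigma>2, t1 + 3 + t2, max (stored \<sigma>) (max m1 m2))}}"

text \<open>
  \<^term>\<open>For x lo hi c\<close> runs over lo, lo + 1, ... up to and including hi; both bounds are
  evaluated once, on entry. While the loop runs, two further numbers are held outside the
  store, the counter and the upper bound; their initialisation is charged two operations.
\<close>

primrec exec :: "arrays \<Rightarrow> com \<Rightarrow> store \<Rightarrow> (bool \<times> store \<times> nat \<times> nat) option" where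
  "exec I (Assign x e) \<sigma> = do {
     (v, t, m) \<leftarrow> eval I \<sigma> e;
     Some (False, \<sigma>(x \<mapsto> v), t + 1, max (stored \<sigma> + m) (stored (\<sigma>(x \<mapsto> v))))}"
| "exec I (Seq c1 c2) \<sigma> = do {
     (brk1, \<sigma>1, t1, m1) \<leftarrow> exec I c1 \<sigma>;
     if brk1 then Some (True, \<sigma>1, t1, m1)
     else do {
       (brk2, \<sigma>2, t2, m2) \<leftarrow> exec I c2 \<sigma>1;
       Some (brk2, \<sigma>2, t1 + t2, max m1 m2)}}"
| "exec I (If_Less e1 e2 c1 c2) \<sigma> = do {
     (v1, t1, m1) \<leftarrow> eval I \<sigma> e1;
     (v2, t2, m2) \<leftarrow> eval I \<sigma> e2;
     (brk, \<sigma>', t, m) \<leftarrow> (if v1 < v2 then exec I c1 \<sigma> else exec I c2 \<sigma>);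
     Some (brk, \<sigma>', t1 + t2 + 1 + t, max (stored \<sigma> + max m1 (1 + m2)) m)}"
| "exec I (For x lo hi c) \<sigma> = do {
     (a, ta, ma) \<leftarrow> eval I \<sigma> lo;
     (b, tb, mb) \<leftarrow> eval I \<sigma> hi;
     (\<sigma>', t, m) \<leftarrow> iterate (exec I c) x (map (\<lambda>k. a + real k) [0..<nat (\<lfloor>b - a\<rfloor> + 1)]) \<sigma>;
     Some (False, \<sigma>', ta + tb + 2 + t, max (stored \<sigma> + max ma (1 + mb)) (2 + m))}"
| "exec I Break \<sigma> = Some (True, \<sigma>, 1, stored \<sigma>)"

text \<open>
  Running a procedure, given by its body and the returned expression, with no variable set
  initially: returned value, time, and peak auxiliary memory.
\<close>

definition run :: "arrays \<Rightarrow> com \<Rightarrow> exp \<Rightarrow> (real \<times> nat \<times> nat) option" where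
  "run I c e = do {
     (brk, \<sigma>, t, m) \<leftarrow> exec I c Map.empty;
     (v, t', m') \<leftarrow> eval I \<sigma> e;
     Some (v, t + t' + 1, max m (stored \<sigma> + m'))}"


section \<open>The procedure\<close>

definition plus_one :: "string \<Rightarrow> exp" where
  "plus_one x = Bin Add (Var x) (Const 1)"

definition minus_one :: "string \<Rightarrow> exp" where
  "minus_one x = Bin Sub (Var x) (Const 1)"

definition inner_body :: com where
  "inner_body =
     Seq (Assign ''m''
            (Bin Sub
              (Bin Minimum (Elem ''C1'' (plus_one ''i'')) (Elem ''C2'' (plus_one ''j'')))
              (Bin Maximum (Elem ''C1'' (Var ''i'')) (Elem ''C2'' (Var ''j'')))))
    (Seq (Assign ''m'' (Bin Maximum (Const 0) (Var ''m'')))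
    (Seq (Assign ''d''
            (Bin Add (Var ''d'')
              (Bin Mul (Var ''m'')
                (Absolute
                  (Bin Sub (Elem ''C1'' (plus_one ''i'')) (Elem ''C2'' (plus_one ''j'')))))))
         (If_Less (Elem ''C1'' (plus_one ''i'')) (Elem ''C2'' (plus_one ''j''))
            Break
            (Assign ''b'' (plus_one ''j'')))))"

definition ricpd_body :: com where
  "ricpd_body =
     Seq (Assign ''r'' (Bin Sub (Size ''C1'') (Const 1)))
    (Seq (Assign ''s'' (Bin Sub (Size ''C2'') (Const 1)))
    (Seq (Assign ''d'' (Const 0))
    (Seq (Assign ''b'' (Const 0))
    (Seq (For ''i'' (Const 0) (minus_one ''r'')
           (For ''j'' (Var ''b'') (minus_one ''s'')
              inner_body))
         (Assign ''N'' (Elem ''C1'' (Var ''r'')))))))"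

text \<open>The binomial coefficient is computed as N (N - 1) / 2.\<close>

definition ricpd_return :: exp where
  "ricpd_return =
     Bin Sub (Const 1)
       (Bin Div (Var ''d'')
         (Bin Div (Bin Mul (Var ''N'') (minus_one ''N'')) (Const 2)))"

definition ricpd :: "int list \<Rightarrow> int list \<Rightarrow> (real \<times> nat \<times> nat) option" where
  "ricpd C1 C2 = run [''C1'' \<mapsto> C1, ''C2'' \<mapsto> C2] ricpd_body ricpd_return"

end

theory Submission
  imports Defs
begin

text \<open>
  Let e(t) and f(t) be the right ends of the clusters of t in the two clusterings. For t < u, the
  clusterings disagree on (t, u) iff exactly one of u \<le> e(t), u \<le> f(t) holds, so
  the number of disagreeing pairs is the sum of |e(t) - f(t)| over t. The procedure merges the two
  change-point lists and so enumerates the nonempty intersections of the clusters in increasing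
  order. On each of these e and f are constant, and d accumulates the sum. Every inner iteration
  either advances b or ends the current iteration of the outer loop, hence the linear time.
\<close>

section \<open>The Rand Index of two change-point clusterings\<close>

text \<open>For \<open>C ! 0 < t \<le> C ! r\<close>, with \<open>r\<close> the last index, this is
  the right end of the cluster containing \<open>t\<close>: the e(t) or f(t) of the overview. The
  function is total, but only values in that range matter.\<close>

definition cluster_end :: "int list \<Rightarrow> int \<Rightarrow> int" where
  "cluster_end C t = C ! (LEAST k. t \<le> C ! k)"

lemma sorted_wrt_less_nth_mono:
  fixes C :: "int list"
  assumes "sorted_wrt (<) C" "k \<le> l" "l < length C"
  shows "C ! k \<le> C ! l"
  using assms by (cases "k = l") (auto simp: sorted_wrt_iff_nth_less intro: less_imp_le)

lemma cluster_end_eq: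
  assumes "sorted_wrt (<) C" "k + 1 < length C" "C ! k < t" "t \<le> C ! (k + 1)"
  shows "cluster_end C t = C ! (k + 1)"
proof -
  have "(LEAST k. t \<le> C ! k) = k + 1"
  proof (rule Least_equality)
    fix l assume l: "t \<le> C ! l"
    show "k + 1 \<le> l"
    proof (rule ccontr)
      assume "\<not> k + 1 \<le> l"
      then have "C ! l \<le> C ! k"
        using sorted_wrt_less_nth_mono[OF assms(1), of l k] assms(2) by simp
      with l assms(3) show False by simp
    qed
  qed (fact assms(4))
  then show ?thesis by (simp add: cluster_end_def)
qed

lemma ex_cluster_index:
  fixes C :: "int list"
  assumes "C ! 0 < t" "t \<le> C ! r"
  obtains k where "k < r" "C ! k < t" "t \<le> C ! (k + 1)"
proof -
  have "\<exists>k<r. (\<forall>i\<le>k. \<not> t \<le> C ! i) \<and> t \<le> C ! (Suc k)"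
    using assms by (intro ex_least_nat_less) auto
  with that show ?thesis by (metis Suc_eq_plus1 not_less order_refl)
qed

lemma cluster_end_bounds:
  assumes "sorted_wrt (<) C" "length C = r + 1" "C ! 0 < t" "t \<le> C ! r"
  shows "t \<le> cluster_end C t" "cluster_end C t \<le> C ! r"
proof -
  obtain k where k: "k < r" "C ! k < t" "t \<le> C ! (k + 1)"
    using assms(3,4) by (rule ex_cluster_index)
  then have "cluster_end C t = C ! (k + 1)"
    using assms by (intro cluster_end_eq) auto
  with k show "t \<le> cluster_end C t" "cluster_end C t \<le> C ! r"
    using assms sorted_wrt_less_nth_mono[of C "k + 1" r] by auto
qed

text \<open>The left end of the cluster of \<open>t\<close> lies before \<open>t\<close>, hence
  before \<open>u\<close>, so only its right end decides whether \<open>u\<close> still belongs to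
  it.\<close>

lemma same_cluster_change_point_clustering:
  assumes C: "sorted_wrt (<) C" "length C = r + 1"
    and tu: "C ! 0 < t" "t < u" "u \<le> C ! r"
  shows "same_cluster (change_point_clustering C) t u = (if u \<le> cluster_end C t then 1 else 0)"
proof -
  have *: "cluster_end C t = C ! (k + 1)" if "k + 1 < length C" "C ! k < t" "t \<le> C ! (k + 1)" for k
    using cluster_end_eq[OF C(1) that] .
  obtain k where k: "k < r" "C ! k < t" "t \<le> C ! (k + 1)"
    using tu by (auto intro: ex_cluster_index[of C t r])
  have "(\<exists>A\<in>change_point_clustering C. t \<in> A \<and> u \<in> A) \<longleftrightarrow>
      (\<exists>k. k + 1 < length C \<and> C ! k < t \<and> t \<le> C ! (k + 1) \<and> C ! k < u \<and> u \<le> C ! (k + 1))"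
    unfolding change_point_clustering_def by (auto simp: add1_zle_eq)
  also have "\<dots> \<longleftrightarrow> u \<le> cluster_end C t"
  proof
    assume "u \<le> cluster_end C t"
    then show "\<exists>k. k + 1 < length C \<and> C ! k < t \<and> t \<le> C ! (k + 1) \<and> C ! k < u \<and> u \<le> C ! (k + 1)"
      using k * tu C(2) by (intro exI[of _ k]) auto
  qed (use * in auto)
  finally show ?thesis by (simp add: same_cluster_def)
qed

section \<open>Counting the agreeing pairs\<close>

lemma sum_int_atLeastAtMost:
  fixes N :: int
  assumes "0 \<le> N"
  shows "2 * \<Sum>{1..N} = N * (N + 1)"
  using assms
proof (induction N rule: int_ge_induct)
  case (step N)
  have "{1..N + 1} = insert (N + 1) {1..N}" using step.hyps by auto
  then show ?case using step.IH by (simp add: algebra_simps)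
qed simp

text \<open>Links the binomial coefficient of \<open>rand_index\<close> to the product formula that
  \<open>ricpd_return\<close> evaluates.\<close>

lemma real_choose_two:
  assumes "0 \<le> N"
  shows "real (nat N choose 2) = real_of_int N * (real_of_int N - 1) / 2"
proof -
  have "real (n choose 2) = real n * (real n - 1) / 2" for n
    by (induction n) (auto simp: numeral_2_eq_2 field_simps)
  from this[of "nat N"] assms show ?thesis by simp
qed

text \<open>The two comparisons differ exactly for \<open>u\<close> in
  \<open>{min e f<..max e f}\<close>, an interval of length |e - f| inside \<open>{t<..N}\<close>;
  the rest of \<open>{t<..N}\<close> is counted.\<close>

lemma card_agreeing_partners:
  fixes t N e f :: int
  assumes "t \<le> e" "e \<le> N" "t \<le> f" "f \<le> N"
  shows "int (card {u \<in> {t<..N}. (u \<le> e) = (u \<le> f)}) = N - t - \<bar>e - f\<bar>"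
proof -
  have "{u \<in> {t<..N}. (u \<le> e) = (u \<le> f)} = {t<..N} - {min e f<..max e f}"
    by auto
  moreover have "card ({t<..N} - {min e f<..max e f}) = card {t<..N} - card {min e f<..max e f}"
    using assms by (intro card_Diff_subset) auto
  ultimately show ?thesis using assms by (auto simp: nat_diff_distrib min_def max_def)
qed

lemma rand_index_change_point_clustering:
  assumes N: "2 \<le> N"
    and C1: "sorted_wrt (<) C1" "length C1 = r + 1" "C1 ! 0 = 0" "C1 ! r = N"
    and C2: "sorted_wrt (<) C2" "length C2 = s + 1" "C2 ! 0 = 0" "C2 ! s = N"
  shows "rand_index N (change_point_clustering C1) (change_point_clustering C2) =
    1 - real_of_int (\<Sum>t\<in>{1..N}. \<bar>cluster_end C1 t - cluster_end C2 t\<bar>) /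
        (real_of_int N * (real_of_int N - 1) / 2)"
proof -
  define D where "D = (\<Sum>t\<in>{1..N}. \<bar>cluster_end C1 t - cluster_end C2 t\<bar>)"
  define S where "S v = {(t, u). t \<in> {1..N} \<and> u \<in> {1..N} \<and> t < u \<and>
      same_cluster (change_point_clustering C1) t u = v \<and>
      same_cluster (change_point_clustering C2) t u = v}" for v
  define T where "T t = {u \<in> {t<..N}. (u \<le> cluster_end C1 t) = (u \<le> cluster_end C2 t)}" for t
  have fin: "finite (S v)" for v
    by (rule finite_subset[of _ "{1..N} \<times> {1..N}"]) (auto simp: S_def)
  \<comment> \<open>Agreeing pairs are grouped by their smaller element \<open>t\<close>: the value
    0 or 1 is common to both clusterings iff the comparisons of \<open>u\<close> with the two
    cluster ends have the same truth value.\<close>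
  have un: "S 0 \<union> S 1 = Sigma {1..N} T"
  proof (intro set_eqI, clarify)
    fix t u
    show "(t, u) \<in> S 0 \<union> S 1 \<longleftrightarrow> (t, u) \<in> Sigma {1..N} T"
    proof (cases "1 \<le> t \<and> t < u \<and> u \<le> N")
      case True
      then show ?thesis
        using same_cluster_change_point_clustering[of C1 r t u]
          same_cluster_change_point_clustering[of C2 s t u] C1 C2
        by (simp add: S_def T_def)
    qed (auto simp: S_def T_def)
  qed
  have "S 0 \<inter> S 1 = {}" by (auto simp: S_def)
  then have "agreeing_pairs 0 N (change_point_clustering C1) (change_point_clustering C2) +
      agreeing_pairs 1 N (change_point_clustering C1) (change_point_clustering C2) =
      card (S 0 \<union> S 1)"
    using fin by (simp add: card_Un_disjoint agreeing_pairs_def S_def)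
  moreover have "int (card (S 0 \<union> S 1)) = (\<Sum>t\<in>{1..N}. int (card (T t)))"
    unfolding un by (subst card_SigmaI) (auto simp: T_def intro: finite_subset[of _ "{t<..N}" for t])
  moreover have "\<dots> = (\<Sum>t\<in>{1..N}. N - t - \<bar>cluster_end C1 t - cluster_end C2 t\<bar>)"
  proof (intro sum.cong refl)
    fix t assume "t \<in> {1..N}"
    then show "int (card (T t)) = N - t - \<bar>cluster_end C1 t - cluster_end C2 t\<bar>"
      unfolding T_def
      using cluster_end_bounds[of C1 r t] cluster_end_bounds[of C2 s t] C1 C2
      by (intro card_agreeing_partners) auto
  qed
  moreover have "\<dots> = N * N - \<Sum>{1..N} - D"
    using N by (simp add: sum_subtractf D_def)
  \<comment> \<open>Doubling keeps the count in the integers: the sum of 1, ..., N contributes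
    \<open>N * (N + 1)\<close>, which leaves \<open>N * N - N = N * (N - 1)\<close>.\<close>
  ultimately have "2 * int (agreeing_pairs 0 N (change_point_clustering C1) (change_point_clustering C2) +
      agreeing_pairs 1 N (change_point_clustering C1) (change_point_clustering C2)) = N * (N - 1) - 2 * D"
    using sum_int_atLeastAtMost[of N] N by (simp add: algebra_simps)
  then have "2 * real (agreeing_pairs 0 N (change_point_clustering C1) (change_point_clustering C2) +
      agreeing_pairs 1 N (change_point_clustering C1) (change_point_clustering C2)) =
      real_of_int N * (real_of_int N - 1) - 2 * real_of_int D"
    by (metis (mono_tags, opaque_lifting) of_int_diff of_int_mult of_int_numeral of_int_of_nat_eq of_int_1)
  moreover have "real_of_int N * (real_of_int N - 1) \<noteq> 0" using N by simp
  ultimately show ?thesis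
    using N unfolding rand_index_def D_def[symmetric]
    by (simp add: real_choose_two field_simps)
qed

section \<open>Execution of the procedure\<close>

text \<open>These are all the variables that the program assigns. Confining every store to this
  fixed set bounds the memory independently of the input.\<close>

definition scalars :: "string set" where
  "scalars = {''r'', ''s'', ''d'', ''b'', ''i'', ''j'', ''m'', ''N''}"

lemma in_scalars [simp]:
  "''r'' \<in> scalars" "''s'' \<in> scalars" "''d'' \<in> scalars" "''b'' \<in> scalars"
  "''i'' \<in> scalars" "''j'' \<in> scalars" "''m'' \<in> scalars" "''N'' \<in> scalars"
  by (simp_all add: scalars_def)

lemma stored_le:
  assumes "dom \<sigma> \<subseteq> scalars"
  shows "stored \<sigma> \<le> 8"
proof -
  have "card (dom \<sigma>) \<le> card scalars" using assms by (intro card_mono) (auto simp: scalars_def)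
  also have "\<dots> \<le> 8" by (simp add: scalars_def)
  finally show ?thesis by (simp add: stored_def)
qed

lemma read_array_of_nat:
  "k < length A \<Longrightarrow> read_array A (real k) = Some (real_of_int (A ! k))"
  by (simp add: read_array_def)

lemma eval_Elem_Var:
  assumes "I a = Some A" "\<sigma> x = Some (real k)" "k < length A"
  shows "eval I \<sigma> (Elem a (Var x)) = Some (real_of_int (A ! k), 1, 1)"
  using assms by (simp add: read_array_of_nat)

lemma eval_plus_one:
  assumes "\<sigma> x = Some (real k)"
  shows "eval I \<sigma> (plus_one x) = Some (real (k + 1), 1, 2)"
  using assms by (simp add: plus_one_def)

lemma eval_Elem_plus_one:
  assumes "I a = Some A" "\<sigma> x = Some (real k)" "k + 1 < length A"
  shows "eval I \<sigma> (Elem a (plus_one x)) = Some (real_of_int (A ! (k + 1)), 2, 2)"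
  using assms(1) read_array_of_nat[OF assms(3)] eval_plus_one[of \<sigma> x k I, OF assms(2)]
  by simp

text \<open>The left side is the list of counter values that \<open>exec\<close> builds for a loop
  from \<open>a\<close> to \<open>n - 1\<close>. Truncation by \<open>nat\<close> matches the empty
  \<open>[a..<n]\<close> when \<open>n \<le> a\<close>.\<close>

lemma For_range:
  "map (\<lambda>k. real a + real k) [0..<nat (\<lfloor>real n - 1 - real a\<rfloor> + 1)] = map real [a..<n]"
proof -
  have "real n - 1 - real a = real_of_int (int n - 1 - int a)" by simp
  then have "nat (\<lfloor>real n - 1 - real a\<rfloor> + 1) = n - a" by (simp only: floor_of_int)
  then show ?thesis by (intro nth_equalityI) auto
qed

section \<open>The merge invariant and the inner loop\<close>

locale ricpd_input =
  fixes N :: int and r s :: nat and C1 C2 :: "int list"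
  assumes N: "2 \<le> N"
    and rs: "1 \<le> r" "1 \<le> s"
    and C1: "sorted_wrt (<) C1" "length C1 = r + 1" "C1 ! 0 = 0" "C1 ! r = N"
    and C2: "sorted_wrt (<) C2" "length C2 = s + 1" "C2 ! 0 = 0" "C2 ! s = N"
begin

abbreviation input :: arrays where
  "input \<equiv> [''C1'' \<mapsto> C1, ''C2'' \<mapsto> C2]"

text \<open>For \<open>x \<le> N\<close> this is the number of disagreeing pairs (t, u) with
  \<open>t < u\<close> and \<open>t \<le> x\<close>. It is the value that d should have once the
  merge has reached \<open>x\<close>.\<close>

definition disagreements :: "int \<Rightarrow> int" where
  "disagreements x = (\<Sum>t\<in>{1..x}. \<bar>cluster_end C1 t - cluster_end C2 t\<bar>)"

text \<open>The interval \<open>{x<..y}\<close> is the intersection of cluster \<open>i\<close> of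
  \<open>C1\<close> with cluster \<open>j\<close> of \<open>C2\<close>, so both cluster ends are
  constant on it. Equality in \<open>C2 ! j \<le> C1 ! (i + 1)\<close> is allowed: it occurs in the
  inner iteration after a common change-point, where the intersection is empty and m is 0.\<close>

lemma disagreements_step:
  assumes "i < r" "j < s" "C1 ! i < C2 ! (j + 1)" "C2 ! j \<le> C1 ! (i + 1)"
  defines "x \<equiv> max (C1 ! i) (C2 ! j)" and "y \<equiv> min (C1 ! (i + 1)) (C2 ! (j + 1))"
  shows "x \<le> y"
    and "disagreements y = disagreements x + (y - x) * \<bar>C1 ! (i + 1) - C2 ! (j + 1)\<bar>"
proof -
  have "C1 ! i \<le> C1 ! (i + 1)" "C2 ! j \<le> C2 ! (j + 1)" "0 \<le> C1 ! i"
    using assms C1 C2 sorted_wrt_less_nth_mono[of C1 i "i + 1"]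
      sorted_wrt_less_nth_mono[of C2 j "j + 1"] sorted_wrt_less_nth_mono[of C1 0 i] by auto
  with assms show xy: "x \<le> y" by auto
  \<comment> \<open>Nonnegativity of \<open>x\<close> is what lets \<open>{1..y}\<close> split at
    \<open>x\<close>.\<close>
  have "0 \<le> x" using \<open>0 \<le> C1 ! i\<close> by (simp add: x_def)
  with xy have "{1..y} = {1..x} \<union> {x<..y}" by auto
  then have "disagreements y =
      disagreements x + (\<Sum>t\<in>{x<..y}. \<bar>cluster_end C1 t - cluster_end C2 t\<bar>)"
    unfolding disagreements_def by (auto intro: sum.union_disjoint)
  also have "(\<Sum>t\<in>{x<..y}. \<bar>cluster_end C1 t - cluster_end C2 t\<bar>) =
      (\<Sum>t\<in>{x<..y}. \<bar>C1 ! (i + 1) - C2 ! (j + 1)\<bar>)"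
    using assms C1 C2 by (intro sum.cong refl) (simp add: cluster_end_eq)
  finally show "disagreements y = disagreements x + (y - x) * \<bar>C1 ! (i + 1) - C2 ! (j + 1)\<bar>"
    using xy by simp
qed

text \<open>The frontier \<^term>\<open>x\<close> is the right end of the part of the sum that d has accumulated so far.\<close>

definition state :: "store \<Rightarrow> nat \<Rightarrow> int \<Rightarrow> bool" where
  "state \<sigma> b x \<longleftrightarrow> dom \<sigma> \<subseteq> scalars \<and> \<sigma> ''r'' = Some (real r) \<and> \<sigma> ''s'' = Some (real s) \<and>
     \<sigma> ''b'' = Some (real b) \<and> \<sigma> ''d'' = Some (real_of_int (disagreements x))"

text \<open>One iteration moves the frontier from the left to the right end of the current
  intersection. On a break \<open>b\<close> stays at \<open>j\<close>, since cluster
  \<open>j\<close> of \<open>C2\<close> reaches beyond \<open>C1 ! (i + 1)\<close> and also meets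
  the next cluster of \<open>C1\<close>. The bounds 40 and 20 are round: the four statements cost at
  most 10 + 2 + 9 + 7 operations, and at most 8 variables and 5 temporaries are held.\<close>

lemma exec_inner_body:
  assumes st: "state \<sigma> j (max (C1 ! i) (C2 ! j))" and i: "\<sigma> ''i'' = Some (real i)"
    and ij: "i < r" "j < s" "C1 ! i < C2 ! (j + 1)" "C2 ! j \<le> C1 ! (i + 1)"
  defines "brk \<equiv> C1 ! (i + 1) < C2 ! (j + 1)"
  obtains \<sigma>' t m where
    "exec input inner_body (\<sigma>(''j'' \<mapsto> real j)) = Some (brk, \<sigma>', t, m)"
    "state \<sigma>' (if brk then j else j + 1) (min (C1 ! (i + 1)) (C2 ! (j + 1)))"
    "\<sigma>' ''i'' = Some (real i)" "t \<le> 40" "m \<le> 20"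
proof -
  define x y where "x = max (C1 ! i) (C2 ! j)" and "y = min (C1 ! (i + 1)) (C2 ! (j + 1))"
  define mv where "mv = real_of_int y - real_of_int x"
  define D where "D = real_of_int (disagreements y)"
  note step = disagreements_step[OF ij, folded x_def y_def]
  have mv: "min (real_of_int (C1 ! (i + 1))) (real_of_int (C2 ! (j + 1))) -
      max (real_of_int (C1 ! i)) (real_of_int (C2 ! j)) = mv"
    by (simp add: mv_def x_def y_def of_int_min of_int_max)
  \<comment> \<open>The truncation at 0 changes nothing here, because the invariant excludes a
    negative overlap.\<close>
  have mv0: "max 0 mv = mv" using step(1) by (simp add: mv_def)
  have D: "real_of_int (disagreements x) +
      mv * \<bar>real_of_int (C1 ! (i + 1)) - real_of_int (C2 ! (j + 1))\<bar> = D"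
    using step(2) by (simp add: D_def mv_def)
  define \<sigma>1 where "\<sigma>1 = \<sigma>(''j'' \<mapsto> real j)"
  define \<sigma>2 where "\<sigma>2 = \<sigma>1(''m'' \<mapsto> mv)"
  define \<sigma>3 where "\<sigma>3 = \<sigma>2(''d'' \<mapsto> D)"
  define \<sigma>4 where "\<sigma>4 = \<sigma>3(''b'' \<mapsto> real (j + 1))"
  note \<sigma>_defs = \<sigma>1_def \<sigma>2_def \<sigma>3_def \<sigma>4_def
  have st': "dom \<sigma> \<subseteq> scalars" "\<sigma> ''r'' = Some (real r)" "\<sigma> ''s'' = Some (real s)"
    "\<sigma> ''b'' = Some (real j)" "\<sigma> ''d'' = Some (real_of_int (disagreements x))"
    using st by (auto simp: state_def x_def)
  have le8: "stored \<sigma>1 \<le> 8" "stored \<sigma>2 \<le> 8" "stored \<sigma>3 \<le> 8" "stored \<sigma>4 \<le> 8"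
    using st'(1) by (simp_all add: stored_le \<sigma>_defs)
  have var_ij: "\<sigma>' ''i'' = Some (real i)" "\<sigma>' ''j'' = Some (real j)" if "\<sigma>' \<in> {\<sigma>1, \<sigma>2, \<sigma>3}" for \<sigma>'
    using that i by (auto simp: \<sigma>_defs)
  have elem: "eval input \<sigma>' (Elem ''C1'' (Var ''i'')) = Some (real_of_int (C1 ! i), 1, 1)"
    "eval input \<sigma>' (Elem ''C2'' (Var ''j'')) = Some (real_of_int (C2 ! j), 1, 1)"
    "eval input \<sigma>' (Elem ''C1'' (plus_one ''i'')) = Some (real_of_int (C1 ! (i + 1)), 2, 2)"
    "eval input \<sigma>' (Elem ''C2'' (plus_one ''j'')) = Some (real_of_int (C2 ! (j + 1)), 2, 2)"
    if "\<sigma>' \<in> {\<sigma>1, \<sigma>2, \<sigma>3}" for \<sigma>'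
    using ij C1 C2 var_ij[OF that] by (intro eval_Elem_Var eval_Elem_plus_one; simp)+
  have 1: "exec input (Assign ''m''
            (Bin Sub
              (Bin Minimum (Elem ''C1'' (plus_one ''i'')) (Elem ''C2'' (plus_one ''j'')))
              (Bin Maximum (Elem ''C1'' (Var ''i'')) (Elem ''C2'' (Var ''j''))))) \<sigma>1 =
     Some (False, \<sigma>2, 10, max (stored \<sigma>1 + 3) (stored \<sigma>2))"
    by (simp add: elem mv \<sigma>2_def del: eval.simps(4) One_nat_def)
  have 2: "exec input (Assign ''m'' (Bin Maximum (Const 0) (Var ''m''))) \<sigma>2 =
     Some (False, \<sigma>2, 2, stored \<sigma>2 + 2)"
    by (simp add: mv0 \<sigma>2_def)
  have 3: "exec input (Assign ''d''
            (Bin Add (Var ''d'')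
              (Bin Mul (Var ''m'')
                (Absolute
                  (Bin Sub (Elem ''C1'' (plus_one ''i'')) (Elem ''C2'' (plus_one ''j''))))))) \<sigma>2 =
     Some (False, \<sigma>3, 9, max (stored \<sigma>2 + 5) (stored \<sigma>3))"
  proof -
    have "\<sigma>2 ''m'' = Some mv" "\<sigma>2 ''d'' = Some (real_of_int (disagreements x))"
      using st' by (simp_all add: \<sigma>_defs)
    then show ?thesis
      by (simp add: elem D \<sigma>3_def del: eval.simps(4) One_nat_def)
  qed
  have 4: "exec input (If_Less (Elem ''C1'' (plus_one ''i'')) (Elem ''C2'' (plus_one ''j''))
            Break (Assign ''b'' (plus_one ''j''))) \<sigma>3 =
     (if brk then Some (True, \<sigma>3, 6, stored \<sigma>3 + 3)
      else Some (False, \<sigma>4, 7, max (stored \<sigma>3 + 3) (stored \<sigma>4)))"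
    using var_ij(2)[of \<sigma>3]
    by (simp add: elem eval_plus_one brk_def \<sigma>4_def del: eval.simps(4) One_nat_def)
      (simp add: max_def)
  define \<sigma>' where "\<sigma>' = (if brk then \<sigma>3 else \<sigma>4)"
  have "\<exists>t m. exec input inner_body \<sigma>1 = Some (brk, \<sigma>', t, m) \<and> t \<le> 40 \<and> m \<le> 20"
    using le8 by (simp add: inner_body_def 1 2 3 4 \<sigma>'_def del: exec.simps(1,3))
  moreover have "state \<sigma>' (if brk then j else j + 1) y"
    using st' by (auto simp: state_def \<sigma>'_def \<sigma>_defs D_def)
  moreover have "\<sigma>' ''i'' = Some (real i)"
    using i by (simp add: \<sigma>'_def \<sigma>_defs)
  ultimately show thesis
    using that unfolding \<sigma>1_def y_def by blast
qed

text \<open>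
  Whenever an inner iteration starts, b equals j; this is why \<^term>\<open>state \<sigma> j\<close> appears below.
  The bound 43 per iteration is amortised against the growth of b.
\<close>

lemma iterate_inner_body:
  assumes "state \<sigma> j (max (C1 ! i) (C2 ! j))" "\<sigma> ''i'' = Some (real i)"
    and "i < r" "j < s" "C1 ! i < C2 ! (j + 1)" "C2 ! j \<le> C1 ! (i + 1)"
  shows "\<exists>b \<sigma>' t m. iterate (exec input inner_body) ''j'' (map real [j..<s]) \<sigma> = Some (\<sigma>', t, m) \<and>
    state \<sigma>' b (C1 ! (i + 1)) \<and> b \<le> s \<and> C2 ! b \<le> C1 ! (i + 1) \<and>
    (i + 1 < r \<longrightarrow> b < s \<and> C1 ! (i + 1) < C2 ! (b + 1)) \<and>
    t + 43 * j \<le> 43 * b + 44 \<and> m \<le> 20"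
  using assms
proof (induction "s - j" arbitrary: j \<sigma> rule: less_induct)
  case less
  define brk where "brk \<longleftrightarrow> C1 ! (i + 1) < C2 ! (j + 1)"
  obtain \<sigma>1 t1 m1 where body: "exec input inner_body (\<sigma>(''j'' \<mapsto> real j)) = Some (brk, \<sigma>1, t1, m1)"
    and st1: "state \<sigma>1 (if brk then j else j + 1) (min (C1 ! (i + 1)) (C2 ! (j + 1)))"
    and i1: "\<sigma>1 ''i'' = Some (real i)" and bounds: "t1 \<le> 40" "m1 \<le> 20"
    unfolding brk_def using exec_inner_body[OF less.prems] by blast
  have range: "[j..<s] = j # [Suc j..<s]"
    using less.prems by (simp add: upt_conv_Cons)
  have stored: "stored \<sigma> \<le> 8" "stored \<sigma>1 \<le> 8"
    using less.prems(1) st1 by (simp_all add: state_def stored_le)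
  consider (brk) brk | (last) "\<not> brk" "j + 1 = s" | (more) "\<not> brk" "j + 1 < s"
    using less.prems by linarith
  then show ?case
  proof cases
    \<comment> \<open>The breaking iteration costs at most 40 + 3 without advancing
      \<open>b\<close>; the constant 44 absorbs it.\<close>
    case brk
    then show ?thesis
      using less.prems st1 bounds stored body
      by (intro exI[of _ j]) (auto simp: range brk_def)
  next
    case last
    \<comment> \<open>Passing the last cluster of \<open>C2\<close> without a break forces
      \<open>C1 ! (i + 1) = N\<close>, so \<open>i\<close> is the last cluster of \<open>C1\<close>
      and the claim for \<open>i + 1 < r\<close> is vacuous. The failing loop test accounts for the
      1 in 44 = 43 + 1.\<close>
    have "N \<le> C1 ! (i + 1)" using last C2 by (simp add: brk_def)
    moreover have "C1 ! (i + 1) < N" if "i + 1 < r"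
      using C1 that by (auto simp: sorted_wrt_iff_nth_less)
    ultimately have "i + 1 = r" using less.prems by force
    with last show ?thesis
      using C1 C2 st1 bounds stored body
      by (intro exI[of _ s]) (auto simp: range)
  next
    case more
    have "C2 ! (j + 1) < C2 ! (j + 1 + 1)"
      using C2 more by (auto simp: sorted_wrt_iff_nth_less)
    moreover have "s - (j + 1) < s - j" using more by simp
    \<comment> \<open>The frontier just reached is the left end of the next intersection, so the
      invariant holds again at \<open>j + 1\<close>.\<close>
    moreover have "min (C1 ! (i + 1)) (C2 ! (j + 1)) = max (C1 ! i) (C2 ! (j + 1))"
      using more less.prems by (simp add: brk_def)
    ultimately obtain b \<sigma>2 t2 m2 where rest:
      "iterate (exec input inner_body) ''j'' (map real [j + 1..<s]) \<sigma>1 = Some (\<sigma>2, t2, m2)"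
      "state \<sigma>2 b (C1 ! (i + 1))" "b \<le> s" "C2 ! b \<le> C1 ! (i + 1)"
      "i + 1 < r \<longrightarrow> b < s \<and> C1 ! (i + 1) < C2 ! (b + 1)"
      "t2 + 43 * (j + 1) \<le> 43 * b + 44" "m2 \<le> 20"
      using less.hyps[of "j + 1" \<sigma>1] less.prems st1 i1 more by (auto simp: brk_def)
    with more show ?thesis
      using bounds stored body
      by (intro exI[of _ b]) (auto simp: range)
  qed
qed

section \<open>The outer loop\<close>

abbreviation outer_body :: com where
  "outer_body \<equiv> For ''j'' (Var ''b'') (minus_one ''s'') inner_body"

text \<open>At the start the frontier \<open>C1 ! i\<close> lies between \<open>C2 ! b\<close> and
  \<open>C2 ! (b + 1)\<close>, so it is the left end of the first intersection and the inner
  invariant applies with \<open>j = b\<close>. Entering the loop adds 3 operations (44 + 3 = 47),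
  and its counter and upper bound add 2 to the memory.\<close>

lemma exec_outer_body:
  assumes "state \<sigma> b (C1 ! i)" "i < r" "b < s" "C2 ! b \<le> C1 ! i" "C1 ! i < C2 ! (b + 1)"
  obtains b' \<sigma>' t m where
    "exec input outer_body (\<sigma>(''i'' \<mapsto> real i)) = Some (False, \<sigma>', t, m)"
    "state \<sigma>' b' (C1 ! (i + 1))" "b' \<le> s" "C2 ! b' \<le> C1 ! (i + 1)"
    "i + 1 < r \<longrightarrow> b' < s \<and> C1 ! (i + 1) < C2 ! (b' + 1)"
    "t + 43 * b \<le> 43 * b' + 47" "m \<le> 22"
proof -
  let ?\<sigma> = "\<sigma>(''i'' \<mapsto> real i)"
  have st: "state ?\<sigma> b (C1 ! i)" using assms(1) by (simp add: state_def)
  have "C1 ! i \<le> C1 ! (i + 1)"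
    using C1 assms(2) by (intro sorted_wrt_less_nth_mono) auto
  moreover have "max (C1 ! i) (C2 ! b) = C1 ! i" using assms(4) by simp
  ultimately obtain b' \<sigma>' t m where loop:
    "iterate (exec input inner_body) ''j'' (map real [b..<s]) ?\<sigma> = Some (\<sigma>', t, m)"
    "state \<sigma>' b' (C1 ! (i + 1))" "b' \<le> s" "C2 ! b' \<le> C1 ! (i + 1)"
    "i + 1 < r \<longrightarrow> b' < s \<and> C1 ! (i + 1) < C2 ! (b' + 1)"
    "t + 43 * b \<le> 43 * b' + 44" "m \<le> 20"
    using iterate_inner_body[of ?\<sigma> b i] st assms by auto
  have "stored ?\<sigma> \<le> 8" using st by (simp add: state_def stored_le)
  moreover have "?\<sigma> ''b'' = Some (real b)" "?\<sigma> ''s'' = Some (real s)"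
    using st by (simp_all add: state_def)
  ultimately have "\<exists>t m. exec input outer_body ?\<sigma> = Some (False, \<sigma>', t, m) \<and>
      t + 43 * b \<le> 43 * b' + 47 \<and> m \<le> 22"
    using loop(1,6,7) by (simp add: minus_one_def For_range del: fun_upd_apply)
  with loop(2-5) that show thesis by blast
qed

text \<open>Each outer iteration costs 47 + 3 = 50 besides 43 per advance of \<open>b\<close>. The
  advances telescope, and \<open>b' \<le> s\<close> bounds their total, which makes the time linear
  in \<open>r + s\<close> rather than \<open>r * s\<close>. The position of \<open>b\<close> is
  constrained only for \<open>i < r\<close>, since afterwards no cluster of \<open>C1\<close>
  remains.\<close>

lemma iterate_outer_body:
  assumes "state \<sigma> b (C1 ! i)" "i \<le> r" "b \<le> s" "C2 ! b \<le> C1 ! i"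
    and "i < r \<longrightarrow> b < s \<and> C1 ! i < C2 ! (b + 1)"
  shows "\<exists>b' \<sigma>' t m. iterate (exec input outer_body) ''i'' (map real [i..<r]) \<sigma> = Some (\<sigma>', t, m) \<and>
    state \<sigma>' b' N \<and> b' \<le> s \<and> t + 50 * i + 43 * b \<le> 50 * r + 43 * b' + 1 \<and> m \<le> 22"
  using assms
proof (induction "r - i" arbitrary: i b \<sigma> rule: less_induct)
  case less
  have stored: "stored \<sigma> \<le> 8"
    using less.prems(1) by (simp add: state_def stored_le)
  show ?case
  proof (cases "i = r")
    case True
    then show ?thesis using less.prems stored C1 by (intro exI[of _ b]) auto
  next
    case False
    with less.prems obtain b1 \<sigma>1 t1 m1 where body:
      "exec input outer_body (\<sigma>(''i'' \<mapsto> real i)) = Some (False, \<sigma>1, t1, m1)"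
      "state \<sigma>1 b1 (C1 ! (i + 1))" "b1 \<le> s" "C2 ! b1 \<le> C1 ! (i + 1)"
      "i + 1 < r \<longrightarrow> b1 < s \<and> C1 ! (i + 1) < C2 ! (b1 + 1)"
      "t1 + 43 * b \<le> 43 * b1 + 47" "m1 \<le> 22"
      using exec_outer_body[of \<sigma> b i] by (metis le_neq_implies_less)
    have "r - (i + 1) < r - i" using less.prems False by simp
    then obtain b2 \<sigma>2 t2 m2 where rest:
      "iterate (exec input outer_body) ''i'' (map real [i + 1..<r]) \<sigma>1 = Some (\<sigma>2, t2, m2)"
      "state \<sigma>2 b2 N" "b2 \<le> s" "t2 + 50 * (i + 1) + 43 * b1 \<le> 50 * r + 43 * b2 + 1" "m2 \<le> 22"
      using less.hyps[of "i + 1" \<sigma>1 b1] less.prems False body by (auto simp del: exec.simps)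
    have "[i..<r] = i # [i + 1..<r]"
      using less.prems False by (simp add: upt_conv_Cons)
    with body(1,6,7) rest stored show ?thesis
      by (intro exI[of _ b2]) (auto simp del: exec.simps)
  qed
qed

section \<open>The whole procedure\<close>

lemma ricpd_correct:
  "\<exists>t m. ricpd C1 C2 =
      Some (rand_index N (change_point_clustering C1) (change_point_clustering C2), t, m) \<and>
    t \<le> 80 * (r + s) \<and> m \<le> 24"
proof -
  define \<rho>1 :: store where "\<rho>1 = [''r'' \<mapsto> real r]"
  define \<rho>2 where "\<rho>2 = \<rho>1(''s'' \<mapsto> real s)"
  define \<rho>3 where "\<rho>3 = \<rho>2(''d'' \<mapsto> 0)"
  define \<sigma>0 where "\<sigma>0 = \<rho>3(''b'' \<mapsto> 0)"
  note \<rho>_defs = \<rho>1_def \<rho>2_def \<rho>3_def \<sigma>0_def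
  have st0: "state \<sigma>0 0 (C1 ! 0)"
    by (simp add: state_def \<rho>_defs disagreements_def C1)
  \<comment> \<open>This is the condition \<open>C1 ! i < C2 ! (b + 1)\<close> of the outer
    invariant at \<open>i = b = 0\<close>.\<close>
  have "0 < C2 ! 1"
    using sorted_wrt_nth_less[OF C2(1), of 0 1] C2 rs by simp
  then obtain b' \<sigma>' t m where loop:
    "iterate (exec input outer_body) ''i'' (map real [0..<r]) \<sigma>0 = Some (\<sigma>', t, m)"
    "state \<sigma>' b' N" "b' \<le> s" "t \<le> 50 * r + 43 * b' + 1" "m \<le> 22"
    using iterate_outer_body[OF st0] C1 C2 rs by auto
  define \<sigma>'' where "\<sigma>'' = \<sigma>'(''N'' \<mapsto> real_of_int N)"
  have stored: "stored \<sigma>' \<le> 8" "stored \<sigma>'' \<le> 8" "stored \<sigma>0 \<le> 8"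
    using loop(2) st0 by (simp_all add: stored_le state_def \<sigma>''_def)
  have small: "stored \<rho>1 \<le> 8" "stored \<rho>2 \<le> 8" "stored \<rho>3 \<le> 8" "stored Map.empty \<le> 8"
    by (simp_all add: stored_le \<rho>_defs)
  have init:
    "exec input (Assign ''r'' (Bin Sub (Size ''C1'') (Const 1))) Map.empty =
      Some (False, \<rho>1, 3, max (stored Map.empty + 2) (stored \<rho>1))"
    "exec input (Assign ''s'' (Bin Sub (Size ''C2'') (Const 1))) \<rho>1 =
      Some (False, \<rho>2, 3, max (stored \<rho>1 + 2) (stored \<rho>2))"
    "exec input (Assign ''d'' (Const 0)) \<rho>2 =
      Some (False, \<rho>3, 1, max (stored \<rho>2 + 1) (stored \<rho>3))"
    "exec input (Assign ''b'' (Const 0)) \<rho>3 =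
      Some (False, \<sigma>0, 1, max (stored \<rho>3 + 1) (stored \<sigma>0))"
    using C1(2) C2(2) by (simp_all add: \<rho>_defs)
  have main: "exec input (For ''i'' (Const 0) (minus_one ''r'') outer_body) \<sigma>0 =
      Some (False, \<sigma>', t + 3, max (stored \<sigma>0 + 3) (2 + m))"
    using loop(1) For_range[of 0 r] by (simp add: minus_one_def \<rho>_defs)
  have last: "exec input (Assign ''N'' (Elem ''C1'' (Var ''r''))) \<sigma>' =
      Some (False, \<sigma>'', 2, max (stored \<sigma>' + 1) (stored \<sigma>''))"
    using loop(2) C1 by (simp add: eval_Elem_Var[where k = r] state_def \<sigma>''_def del: eval.simps(4))
  \<comment> \<open>The statements outside the loop and the loop entry cost 13, and the final loop
    test 1. The bound 24 is 22 plus the counter and upper bound of the outer loop.\<close>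
  have "\<exists>t m. exec input ricpd_body Map.empty = Some (False, \<sigma>'', t, m) \<and>
      t \<le> 50 * (r + s) + 14 \<and> m \<le> 24"
  proof (intro exI conjI)
    show "exec input ricpd_body Map.empty = Some (False, \<sigma>'', 3 + (3 + (1 + (1 + (t + 3 + 2)))),
        max (max (stored Map.empty + 2) (stored \<rho>1))
          (max (max (stored \<rho>1 + 2) (stored \<rho>2))
            (max (max (stored \<rho>2 + 1) (stored \<rho>3))
              (max (max (stored \<rho>3 + 1) (stored \<sigma>0))
                (max (max (stored \<sigma>0 + 3) (2 + m))
                  (max (stored \<sigma>' + 1) (stored \<sigma>'')))))))"
      by (simp only: ricpd_body_def exec.simps(2) init main last Option.bind_lunit prod.case if_False)
  qed (use loop(3-5) stored small in simp_all)
  moreover have "eval input \<sigma>'' ricpd_return =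
      Some (1 - real_of_int (disagreements N) / (real_of_int N * (real_of_int N - 1) / 2), 5, 5)"
    using loop(2) N by (simp add: ricpd_return_def minus_one_def \<sigma>''_def state_def)
  \<comment> \<open>Evaluating and returning the result adds 6 operations. The total
    \<open>50 * (r + s) + 20\<close> is below \<open>80 * (r + s)\<close> because
    \<open>r + s\<close> is at least 2.\<close>
  ultimately show ?thesis
    using rs stored
    by (auto simp: ricpd_def run_def disagreements_def
        rand_index_change_point_clustering[OF N C1 C2])
qed


end

theorem mainTheorem2:
  shows "\<exists>K M :: nat. \<forall>(N :: int) (r :: nat) (s :: nat) (C1 :: int list) (C2 :: int list).
    2 \<le> N \<longrightarrow> 1 \<le> r \<longrightarrow> 1 \<le> s \<longrightarrow>
    length C1 = r + 1 \<longrightarrow> length C2 = s + 1 \<longrightarrow>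
    sorted_wrt (<) C1 \<longrightarrow> sorted_wrt (<) C2 \<longrightarrow>
    C1 ! 0 = 0 \<longrightarrow> C2 ! 0 = 0 \<longrightarrow> C1 ! r = N \<longrightarrow> C2 ! s = N \<longrightarrow>
    (\<exists>result time memory.
       ricpd C1 C2 = Some (result, time, memory) \<and>
       result = rand_index N (change_point_clustering C1) (change_point_clustering C2) \<and>
       time \<le> K * (r + s) \<and>
       memory \<le> M)"
proof (rule exI[of _ 80], rule exI[of _ 24], intro allI impI, goal_cases)
  case (1 N r s C1 C2)
  then interpret ricpd_input N r s C1 C2 by unfold_locales auto
  show ?case using ricpd_correct by auto
qed

end
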